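(* Let $\sigma=\tau_{r_1(n),r_2(n)}$ and $\eta=\tau_{r_3(m),r_4(m)}$ be horizontal class transpositions with $r_1<r_2$ and $r_3<r_4$. Then every connected component of the graph $\Gamma(\sigma,\eta)$ is a graph of one of the following seven types, or symmetric to one of them (the $k_i$ are integers, and a sequence of vertices denotes the path whose edges are exactly the pairs of consecutive vertices): (1) $a_{k_1}\,b_{k_1}$; (2) $b_{k_1}\,a_{k_1}\,c_{k_2}\,d_{k_2}$; (3) $c_{k_2}\,d_{k_2}\,a_{k_1}\,b_{k_1}$; (4) the 4-cycle with edges $\{a_{k_1},b_{k_1}\},\{b_{k_1},d_{k_2}\},\{d_{k_2},c_{k_2}\},\{c_{k_2},a_{k_1}\}$; (5) $b_{k_1}\,a_{k_1}\,c_{k_2}\,d_{k_2}\,a_{k_3}\,b_{k_3}$; (6) $b_{k_1}\,a_{k_1}\,c_{k_2}\,d_{k_2}\,b_{k_3}\,a_{k_3}$; (7) $b_{k_1}\,a_{k_1}\,c_{k_2}\,d_{k_2}\,a_{k_3}\,b_{k_3}\,c_{k_4}\,d_{k_4}\,b_{k_5}\,a_{k_5}$.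
   Context: For integers $0\le r<m$ write $r(m)=r+m\mathbb{Z}$. If $r_1(m_1)\cap r_2(m_2)=\emptyset$, the class transposition $\tau_{r_1(m_1),r_2(m_2)}$ is the permutation of $\mathbb{Z}$ interchanging $r_1+km_1$ and $r_2+km_2$ for every $k\in\mathbb{Z}$ and fixing every other integer. It is horizontal if $m_1=m_2$. The graph $\Gamma(\sigma,\eta)$ is the undirected graph with vertex set $V=V_1\sqcup V_2$, where $V_1=\{a_k,b_k : k\in\mathbb{Z}\}$ and $V_2=\{c_k,d_k : k\in\mathbb{Z}\}$ are disjoint sets of distinct symbols. Define $\mu:V\to\mathbb{Z}$ by $\mu(a_k)=r_1+nk$, $\mu(b_k)=r_2+nk$, $\mu(c_k)=r_3+mk$, $\mu(d_k)=r_4+mk$. The edges are: all pairs $\{u,v\}$ with one of $u,v$ in $V_1$, the other in $V_2$, and $\mu(u)=\mu(v)$; all pairs $\{u,v\}$ with $u,v\in V_1$ and $\sigma(\mu(u))=\mu(v)$, i.e. the pairs $\{a_k,b_k\}$; and all pairs $\{u,v\}$ with $u,v\in V_2$ and $\eta(\mu(u))=\mu(v)$, i.e. the pairs $\{c_k,d_k\}$. Geometrically, in the plane $\mathbb{R}^2$ each vertex $v\in V_1$ is placed at $(\mu(v),1)$ and each vertex $v\in V_2$ at $(\mu(v),0)$, and edges are the segments connecting the corresponding vertices. Two subgraphs of this graph are called symmetric if one of them can be obtained from the other by reflection with respect to a horizontal or vertical line and renaming the vertices.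
   Formalization: "Symmetric" here ignores horizontal position: letters are renamed uniformly, each line going to a line, so a,b may swap without c,d. Under true reflections the claim fails: for τ_{0(2),1(2)}, τ_{0(3),1(3)} the component a1 b1 c1 d1 a2 b2 is not listed. *)

theory Defs
  imports Complex_Main
begin

section \<open>Class transpositions\<close>

definition residue_class :: "int \<Rightarrow> int \<Rightarrow> int set" where
  "residue_class r m = {r + k * m | k. True}"

definition class_transposition :: "int \<Rightarrow> int \<Rightarrow> int \<Rightarrow> int \<Rightarrow> int \<Rightarrow> int" where
  "class_transposition r1 m1 r2 m2 x =
     (if x \<in> residue_class r1 m1 then r2 + ((x - r1) div m1) * m2
      else if x \<in> residue_class r2 m2 then r1 + ((x - r2) div m2) * m1
      else x)"

lemma class_transposition_swaps:
  assumes "0 < m1" "0 < m2" "residue_class r1 m1 \<inter> residue_class r2 m2 = {}"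
  shows "class_transposition r1 m1 r2 m2 (r1 + k * m1) = r2 + k * m2"
    and "class_transposition r1 m1 r2 m2 (r2 + k * m2) = r1 + k * m1"
proof -
  have "r1 + k * m1 \<in> residue_class r1 m1" "r2 + k * m2 \<in> residue_class r2 m2"
    by (auto simp: residue_class_def)
  moreover from this have "r2 + k * m2 \<notin> residue_class r1 m1"
    using assms(3) by blast
  ultimately show "class_transposition r1 m1 r2 m2 (r1 + k * m1) = r2 + k * m2"
    and "class_transposition r1 m1 r2 m2 (r2 + k * m2) = r1 + k * m1"
    using assms(1,2) by (simp_all add: class_transposition_def)
qed

section \<open>Graphs\<close>

text \<open>A graph is given by its vertex set and its set of edges, each edge being an unordered pair.\<close>

type_synonym 'v ugraph = "'v set \<times> 'v set set"

abbreviation verts :: "'v ugraph \<Rightarrow> 'v set" where "verts \<equiv> fst"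
abbreviation edges :: "'v ugraph \<Rightarrow> 'v set set" where "edges \<equiv> snd"

definition reachable :: "'v ugraph \<Rightarrow> 'v \<Rightarrow> 'v set" where
  "reachable G u = {v. (u, v) \<in> {(x, y). {x, y} \<in> edges G}\<^sup>*}"

definition connected_component_graph :: "'v ugraph \<Rightarrow> 'v ugraph \<Rightarrow> bool" where
  "connected_component_graph G H \<longleftrightarrow>
     (\<exists>u\<in>verts G. H = (reachable G u, {e \<in> edges G. e \<subseteq> reachable G u}))"

definition path_on :: "'v list \<Rightarrow> 'v ugraph \<Rightarrow> bool" where
  "path_on vs G \<longleftrightarrow> distinct vs \<and>
     G = (set vs, {{vs ! i, vs ! Suc i} | i. Suc i < length vs})"

section \<open>The graph of a pair of horizontal class transpositions\<close>

datatype vertex = Va int | Vb int | Vc int | Vd int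

definition V1 :: "vertex set" where "V1 = range Va \<union> range Vb"
definition V2 :: "vertex set" where "V2 = range Vc \<union> range Vd"

fun mu :: "int \<Rightarrow> int \<Rightarrow> int \<Rightarrow> int \<Rightarrow> int \<Rightarrow> int \<Rightarrow> vertex \<Rightarrow> int" where
  "mu r1 r2 n r3 r4 m (Va k) = r1 + n * k"
| "mu r1 r2 n r3 r4 m (Vb k) = r2 + n * k"
| "mu r1 r2 n r3 r4 m (Vc k) = r3 + m * k"
| "mu r1 r2 n r3 r4 m (Vd k) = r4 + m * k"

text \<open>
  \<open>Gamma r1 r2 n r3 r4 m\<close> is the graph $\Gamma(\sigma,\eta)$ of
  $\sigma = \tau_{r_1(n),r_2(n)}$ and $\eta = \tau_{r_3(m),r_4(m)}$.
\<close>

definition Gamma :: "int \<Rightarrow> int \<Rightarrow> int \<Rightarrow> int \<Rightarrow> int \<Rightarrow> int \<Rightarrow> vertex ugraph" where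
  "Gamma r1 r2 n r3 r4 m =
     (let \<mu> = mu r1 r2 n r3 r4 m;
          \<sigma> = class_transposition r1 n r2 n;
          \<eta> = class_transposition r3 m r4 m
      in (V1 \<union> V2,
          {{u, v} | u v. u \<in> V1 \<and> v \<in> V2 \<and> \<mu> u = \<mu> v} \<union>
          {{u, v} | u v. u \<in> V1 \<and> v \<in> V1 \<and> \<sigma> (\<mu> u) = \<mu> v} \<union>
          {{u, v} | u v. u \<in> V2 \<and> v \<in> V2 \<and> \<eta> (\<mu> u) = \<mu> v}))"

section \<open>Symmetric graphs\<close>

definition place :: "int \<Rightarrow> int \<Rightarrow> int \<Rightarrow> int \<Rightarrow> int \<Rightarrow> int \<Rightarrow> vertex \<Rightarrow> real \<times> real" where
  "place r1 r2 n r3 r4 m v = (of_int (mu r1 r2 n r3 r4 m v), if v \<in> V1 then 1 else 0)"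

definition axis_reflection :: "(real \<times> real \<Rightarrow> real \<times> real) \<Rightarrow> bool" where
  "axis_reflection \<rho> \<longleftrightarrow>
     (\<exists>h. \<rho> = (\<lambda>(x, y). (x, 2 * h - y))) \<or> (\<exists>c. \<rho> = (\<lambda>(x, y). (2 * c - x, y)))"

fun same_letter :: "vertex \<Rightarrow> vertex \<Rightarrow> bool" where
  "same_letter (Va _) (Va _) = True"
| "same_letter (Vb _) (Vb _) = True"
| "same_letter (Vc _) (Vc _) = True"
| "same_letter (Vd _) (Vd _) = True"
| "same_letter _ _ = False"

text \<open>
  A renaming is an injective change of names that carries edges to edges and renames the letters
  uniformly: vertices with a common letter, and only those, receive a common letter. The indices
  are renamed freely.

  The position of a vertex is dictated by its name, so a renamed vertex need not stay at its
  reflected point. What the reflection determines is the line of the new vertex: names from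
  \<open>V1\<close> go to vertices whose reflected point lies on $y = 1$, names from \<open>V2\<close> to those
  whose reflected point lies on $y = 0$. In particular, \<open>Va\<close> and \<open>Vb\<close> may be
  exchanged without exchanging \<open>Vc\<close> and \<open>Vd\<close>. This is needed: for
  $\sigma = \tau_{0(2),1(2)}$ and $\eta = \tau_{0(3),1(3)}$ the path
  $a_1\,b_1\,c_1\,d_1\,a_2\,b_2$ is a component, and interchanging only $c$ and $d$ in it gives
  the path $a\,b\,d\,c\,a\,b$, the mirror image of $b\,a\,c\,d\,b\,a$ in a vertical line.
\<close>

definition symmetric_graphs ::
    "int \<Rightarrow> int \<Rightarrow> int \<Rightarrow> int \<Rightarrow> int \<Rightarrow> int \<Rightarrow> vertex ugraph \<Rightarrow> vertex ugraph \<Rightarrow> bool" where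
  "symmetric_graphs r1 r2 n r3 r4 m G H \<longleftrightarrow>
     (\<exists>\<rho> f. axis_reflection \<rho> \<and>
        inj_on f (verts G) \<and>
        H = (f ` verts G, (\<lambda>e. f ` e) ` edges G) \<and>
        (\<forall>u\<in>verts G. \<forall>v\<in>verts G. same_letter (f u) (f v) \<longleftrightarrow> same_letter u v) \<and>
        (\<forall>v\<in>verts G. snd (place r1 r2 n r3 r4 m (f v)) = snd (\<rho> (place r1 r2 n r3 r4 m v))))"

section \<open>The seven types\<close>

definition four_cycle :: "'v \<Rightarrow> 'v \<Rightarrow> 'v \<Rightarrow> 'v \<Rightarrow> 'v ugraph" where
  "four_cycle u v w x = ({u, v, w, x}, {{u, v}, {v, w}, {w, x}, {x, u}})"

definition basic_type :: "vertex ugraph \<Rightarrow> bool" where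
  "basic_type G \<longleftrightarrow>
     (\<exists>k1. path_on [Va k1, Vb k1] G) \<or>
     (\<exists>k1 k2. path_on [Vb k1, Va k1, Vc k2, Vd k2] G) \<or>
     (\<exists>k1 k2. path_on [Vc k2, Vd k2, Va k1, Vb k1] G) \<or>
     (\<exists>k1 k2. G = four_cycle (Va k1) (Vb k1) (Vd k2) (Vc k2)) \<or>
     (\<exists>k1 k2 k3. path_on [Vb k1, Va k1, Vc k2, Vd k2, Va k3, Vb k3] G) \<or>
     (\<exists>k1 k2 k3. path_on [Vb k1, Va k1, Vc k2, Vd k2, Vb k3, Va k3] G) \<or>
     (\<exists>k1 k2 k3 k4 k5. path_on [Vb k1, Va k1, Vc k2, Vd k2, Va k3, Vb k3,
                                 Vc k4, Vd k4, Vb k5, Va k5] G)"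

end

theory Submission
  imports Defs
begin

text \<open>
  Every vertex has one neighbour on its own line (its \<open>partner\<close>) and at most one on the other
  line (a \<open>joint\<close>), so components are paths or cycles in which horizontal edges alternate with
  joints. Put \<open>s = r2 - r1\<close> and \<open>t = r4 - r3\<close>, the lengths of the upper and of the lower
  horizontal edges. Exchanging the lines, one may assume \<open>n \<le> m\<close>.

  Call a horizontal edge inner if both its ends are joints. If an upper edge from \<open>a\<close> to \<open>b\<close>
  is inner, then \<open>s\<close> is congruent modulo \<open>m\<close> to \<open>0\<close>, \<open>t\<close> or \<open>- t\<close>. Since
  \<open>0 < s < m\<close> and \<open>0 < t < m\<close>, this leaves only \<open>s = t\<close>, where the component is a 4-cycle,
  and \<open>s + t = m\<close>, where the component contains the path \<open>c d a b c d\<close>. In the latter case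
  write \<open>y\<close> for the position of the first \<open>c\<close>; the last \<open>d\<close> lies at \<open>y + m + t\<close>. A joint
  of the first \<open>c\<close> with some \<open>b\<close>, or of the last \<open>d\<close> with some \<open>a\<close>, would force
  \<open>n\<close> to divide \<open>m\<close>, and then \<open>r2\<close> and \<open>r3\<close> would be congruent modulo \<open>n\<close> although
  \<open>0 < r2 - r3 < n\<close>. A joint of the first \<open>c\<close> with some \<open>a\<close>, and one of the last \<open>d\<close> with
  some \<open>b\<close>, both exist exactly if \<open>n\<close> divides \<open>t\<close>; the path then continues at both ends, by one
  upper edge each, and stops there. So the component has three horizontal edges or the five of the
  long path (\<open>classified_inner_ab\<close>).

  If no upper edge of the component is inner, then the component is a single upper edge, or a lower
  edge with at most one pendant upper edge at each end (\<open>classified_pendant\<close>).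

  All these components become basic after a permutation of the four letters that maps each line to
  a line, and every such permutation is a renaming along a reflection
  (\<open>symmetric_graphs_map_graph\<close>).
\<close>

section \<open>Components of graphs\<close>

definition component :: "'v ugraph \<Rightarrow> 'v \<Rightarrow> 'v ugraph" where
  "component G u = (reachable G u, {e \<in> edges G. e \<subseteq> reachable G u})"

definition map_graph :: "('v \<Rightarrow> 'w) \<Rightarrow> 'v ugraph \<Rightarrow> 'w ugraph" where
  "map_graph f G = (f ` verts G, (\<lambda>e. f ` e) ` edges G)"

lemma map_graph_comp: "map_graph g (map_graph f G) = map_graph (g \<circ> f) G"
  by (simp add: map_graph_def image_image)

lemma map_graph_id: "map_graph id G = G"
  by (simp add: map_graph_def)

lemma reachable_refl: "u \<in> reachable G u"
  by (simp add: reachable_def)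

lemma reachable_trans: "v \<in> reachable G u \<Longrightarrow> w \<in> reachable G v \<Longrightarrow> w \<in> reachable G u"
  by (auto simp: reachable_def)

lemma reachable_edge: "{u, v} \<in> edges G \<Longrightarrow> v \<in> reachable G u"
  by (auto simp: reachable_def)

lemma reachable_sym: "v \<in> reachable G u \<Longrightarrow> u \<in> reachable G v"
proof -
  have "sym {(x, y). {x, y} \<in> edges G}"
    by (auto simp: sym_def insert_commute)
  then have "sym ({(x, y). {x, y} \<in> edges G}\<^sup>*)"
    by (rule sym_rtrancl)
  then show "v \<in> reachable G u \<Longrightarrow> u \<in> reachable G v"
    unfolding reachable_def mem_Collect_eq by (rule symD)
qed

lemma reachable_closed:
  assumes "v \<in> reachable G u" "u \<in> S"
    and "\<And>x y. x \<in> S \<Longrightarrow> {x, y} \<in> edges G \<Longrightarrow> y \<in> S"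
  shows "v \<in> S"
  using assms(1)[unfolded reachable_def mem_Collect_eq] assms(2)
  by (induction rule: rtrancl_induct) (auto intro: assms(3))

lemma component_cong_edge:
  assumes "{u, v} \<in> edges G"
  shows "component G u = component G v"
proof -
  have "v \<in> reachable G u" "u \<in> reachable G v"
    using reachable_edge[OF assms] by (blast intro: reachable_sym)+
  then have "reachable G u = reachable G v"
    by (blast intro: reachable_trans)
  then show ?thesis by (simp add: component_def)
qed

lemma component_eqI:
  assumes doubletons: "\<forall>e\<in>edges G. \<exists>x y. e = {x, y}"
    and connected: "S \<subseteq> reachable G u" and "u \<in> S"
    and exhaust: "\<And>x y. x \<in> S \<Longrightarrow> {x, y} \<in> edges G \<Longrightarrow> {x, y} \<in> E"
    and E: "\<And>e. e \<in> E \<Longrightarrow> e \<in> edges G \<and> e \<subseteq> S"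
  shows "component G u = (S, E)"
proof -
  have "reachable G u = S"
  proof
    show "reachable G u \<subseteq> S"
      using reachable_closed[OF _ \<open>u \<in> S\<close>] exhaust E by (metis insert_subset subsetI)
  qed (rule connected)
  moreover have "e \<in> E" if "e \<in> edges G" "e \<subseteq> S" for e
    using bspec[OF doubletons that(1)] that exhaust by auto
  ultimately show ?thesis
    using E by (auto simp: component_def)
qed

fun path_edges :: "'v list \<Rightarrow> 'v set set" where
  "path_edges (x # y # zs) = insert {x, y} (path_edges (y # zs))"
| "path_edges _ = {}"

lemma path_edges_conv_nth: "path_edges vs = {{vs ! i, vs ! Suc i} | i. Suc i < length vs}"
proof (induction vs rule: path_edges.induct)
  case (1 x y zs)
  have "{{(x # y # zs) ! i, (x # y # zs) ! Suc i} | i. Suc i < length (x # y # zs)} =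
      insert {x, y} {{(y # zs) ! i, (y # zs) ! Suc i} | i. Suc i < length (y # zs)}"
    (is "?L = ?R")
  proof
    show "?L \<subseteq> ?R"
    proof
      fix e assume "e \<in> ?L"
      then obtain i where i: "e = {(x # y # zs) ! i, (x # y # zs) ! Suc i}"
          "Suc i < length (x # y # zs)" by auto
      then show "e \<in> ?R" by (cases i) auto
    qed
    show "?R \<subseteq> ?L"
    proof
      fix e assume "e \<in> ?R"
      then consider "e = {x, y}"
        | i where "e = {(y # zs) ! i, (y # zs) ! Suc i}" "Suc i < length (y # zs)" by auto
      then show "e \<in> ?L"
      proof cases
        case 1
        then show ?thesis by (intro CollectI exI[of _ 0]) simp
      next
        case (2 i)
        then show ?thesis by (intro CollectI exI[of _ "Suc i"]) simp
      qed
    qed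
  qed
  with 1 show ?case by simp
qed auto

lemma path_on_iff: "path_on vs G \<longleftrightarrow> distinct vs \<and> G = (set vs, path_edges vs)"
  by (simp add: path_on_def path_edges_conv_nth)

lemma path_edges_map: "path_edges (map f vs) = (\<lambda>e. f ` e) ` path_edges vs"
  by (induction vs rule: path_edges.induct) auto

lemma path_edges_subset: "e \<in> path_edges vs \<Longrightarrow> e \<subseteq> set vs"
  by (induction vs rule: path_edges.induct) auto

lemma path_on_mapD:
  assumes "path_on (map f vs) H"
  obtains T where "path_on vs T" "H = map_graph f T"
proof
  show "path_on vs (set vs, path_edges vs)"
    using assms by (auto simp: path_on_iff distinct_map)
  show "H = map_graph f (set vs, path_edges vs)"
    using assms by (auto simp: path_on_iff map_graph_def path_edges_map)
qed

lemma path_reachable: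
  "path_edges vs \<subseteq> edges G \<Longrightarrow> x \<in> set vs \<Longrightarrow> x \<in> reachable G (hd vs)"
proof (induction vs rule: path_edges.induct)
  case (1 a b zs)
  have "b \<in> reachable G a"
    using 1 by (intro reachable_edge) auto
  moreover have "x = a \<or> x \<in> reachable G b"
    using 1 by auto
  ultimately show ?case
    by (metis list.sel(1) reachable_refl reachable_trans)
qed (auto intro: reachable_refl)

text \<open>
  This criterion turns a list of vertices into a whole component: the component cannot leave the
  list, because every edge that touches the list already belongs to the path.
\<close>

lemma component_path:
  assumes "\<forall>e\<in>edges G. \<exists>x y. e = {x, y}"
    and "distinct vs" and path: "path_edges vs \<subseteq> edges G" and u: "u \<in> set vs"
    and exhaust: "\<And>x y. x \<in> set vs \<Longrightarrow> {x, y} \<in> edges G \<Longrightarrow> {x, y} \<in> path_edges vs"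
  shows "path_on vs (component G u)"
proof -
  have "set vs \<subseteq> reachable G u"
    using path_reachable[OF path] reachable_trans[OF reachable_sym[OF path_reachable[OF path u]]]
    by auto
  moreover have "e \<in> edges G \<and> e \<subseteq> set vs" if "e \<in> path_edges vs" for e
    using that path path_edges_subset[OF that] by blast
  ultimately have "component G u = (set vs, path_edges vs)"
    by (intro component_eqI[OF assms(1) _ u]) (assumption | rule exhaust)+
  with \<open>distinct vs\<close> show ?thesis
    by (simp add: path_on_iff)
qed

lemma reachable_map_graph:
  "v \<in> reachable G u \<Longrightarrow> f v \<in> reachable (map_graph f G) (f u)"
  unfolding reachable_def mem_Collect_eq
proof (induction rule: rtrancl_induct)
  case (step y z)
  have "f ` {y, z} \<in> edges (map_graph f G)"
    using step(2) unfolding map_graph_def snd_conv by (intro imageI) simp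
  then have "(f y, f z) \<in> {(x, y). {x, y} \<in> edges (map_graph f G)}"
    by simp
  with step(3) show ?case
    by (rule rtrancl_into_rtrancl)
qed simp

lemma component_map_graph:
  assumes "bij f"
  shows "component (map_graph f G) (f u) = map_graph f (component G u)"
proof -
  have inv: "inv f (f x) = x" "f (inv f y) = y" for x y
    using assms by (auto simp: bij_def surj_f_inv_f)
  then have "inv f \<circ> f = id" by auto
  then have inverse: "map_graph (inv f) (map_graph f G) = G"
    by (simp add: map_graph_comp map_graph_id)
  have reach: "reachable (map_graph f G) (f u) = f ` reachable G u"
  proof
    show "reachable (map_graph f G) (f u) \<subseteq> f ` reachable G u"
    proof
      fix v assume "v \<in> reachable (map_graph f G) (f u)"
      from reachable_map_graph[OF this, of "inv f"] have "inv f v \<in> reachable G u"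
        by (simp add: inverse inv)
      then show "v \<in> f ` reachable G u"
        by (metis imageI inv(2))
    qed
  qed (auto intro: reachable_map_graph)
  have "inj f" using assms by (rule bij_is_inj)
  then have "{e \<in> edges (map_graph f G). e \<subseteq> f ` reachable G u} =
      (\<lambda>e. f ` e) ` {e \<in> edges G. e \<subseteq> reachable G u}"
    by (auto simp: map_graph_def inj_image_subset_iff)
  then show ?thesis
    unfolding component_def reach by (simp add: map_graph_def)
qed

section \<open>Permutations of the letters\<close>

lemma V1_simps [simp]: "Va k \<in> V1" "Vb k \<in> V1" "Vc k \<notin> V1" "Vd k \<notin> V1"
  by (auto simp: V1_def)

lemma V2_eq: "V2 = - V1"
proof -
  have "v \<in> V2 \<longleftrightarrow> v \<notin> V1" for v
    by (cases v) (auto simp: V1_def V2_def)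
  then show ?thesis by auto
qed

text \<open>
  The last conjunct says that each line is mapped to a line: the first alternative corresponds to
  reflections in vertical lines, the second to reflections in horizontal ones.
\<close>

definition letter_permutation :: "(vertex \<Rightarrow> vertex) \<Rightarrow> bool" where
  "letter_permutation f \<longleftrightarrow> bij f \<and> (\<forall>u v. same_letter (f u) (f v) \<longleftrightarrow> same_letter u v) \<and>
     ((\<forall>v. f v \<in> V1 \<longleftrightarrow> v \<in> V1) \<or> (\<forall>v. f v \<in> V1 \<longleftrightarrow> v \<notin> V1))"

fun swap_ab :: "vertex \<Rightarrow> vertex" where
  "swap_ab (Va k) = Vb k" | "swap_ab (Vb k) = Va k"
| "swap_ab (Vc k) = Vc k" | "swap_ab (Vd k) = Vd k"

fun swap_lines :: "vertex \<Rightarrow> vertex" where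
  "swap_lines (Va k) = Vc k" | "swap_lines (Vb k) = Vd k"
| "swap_lines (Vc k) = Va k" | "swap_lines (Vd k) = Vb k"

lemma swap_ab_swap_ab [simp]: "swap_ab (swap_ab v) = v"
  by (cases v) auto

lemma swap_lines_swap_lines [simp]: "swap_lines (swap_lines v) = v"
  by (cases v) auto

lemma bij_swap_lines: "bij swap_lines"
  by (rule o_bij[of swap_lines]) auto

lemma letter_permutation_id: "letter_permutation id"
  by (simp add: letter_permutation_def)

lemma letter_permutation_comp:
  "letter_permutation f \<Longrightarrow> letter_permutation g \<Longrightarrow> letter_permutation (g \<circ> f)"
  unfolding letter_permutation_def by (auto intro: bij_comp)

lemma letter_permutation_swap_ab: "letter_permutation swap_ab"
proof -
  have "bij swap_ab" by (rule o_bij[of swap_ab]) auto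
  moreover have "same_letter (swap_ab u) (swap_ab v) \<longleftrightarrow> same_letter u v" for u v
    by (cases u; cases v) auto
  moreover have "swap_ab v \<in> V1 \<longleftrightarrow> v \<in> V1" for v
    by (cases v) auto
  ultimately show ?thesis by (simp add: letter_permutation_def)
qed

lemma letter_permutation_swap_lines: "letter_permutation swap_lines"
proof -
  have "same_letter (swap_lines u) (swap_lines v) \<longleftrightarrow> same_letter u v" for u v
    by (cases u; cases v) auto
  moreover have "swap_lines v \<in> V1 \<longleftrightarrow> v \<notin> V1" for v
    by (cases v) auto
  ultimately show ?thesis using bij_swap_lines by (simp add: letter_permutation_def)
qed

text \<open>
  Only the second coordinate of a reflected point is prescribed for the renamed vertex. A
  reflection in any vertical line keeps it, and the reflection in the line at height \<open>1/2\<close>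
  interchanges \<open>0\<close> and \<open>1\<close>.
\<close>

lemma symmetric_graphs_map_graph:
  assumes "letter_permutation f"
  shows "symmetric_graphs r1 r2 n r3 r4 m T (map_graph f T)"
proof -
  have "inj_on f (verts T)" and letters: "\<And>u v. same_letter (f u) (f v) \<longleftrightarrow> same_letter u v"
    using assms by (auto simp: letter_permutation_def bij_def intro: inj_on_subset)
  moreover have "\<exists>\<rho>. axis_reflection \<rho> \<and>
      (\<forall>v. snd (place r1 r2 n r3 r4 m (f v)) = snd (\<rho> (place r1 r2 n r3 r4 m v)))"
  proof (cases "\<forall>v. f v \<in> V1 \<longleftrightarrow> v \<in> V1")
    case True
    then have "\<forall>v. snd (place r1 r2 n r3 r4 m (f v)) =
        snd ((\<lambda>(x, y). (2 * 0 - x, y)) (place r1 r2 n r3 r4 m v))"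
      by (auto simp: place_def)
    then show ?thesis
      unfolding axis_reflection_def by blast
  next
    case False
    then have "\<forall>v. f v \<in> V1 \<longleftrightarrow> v \<notin> V1"
      using assms by (auto simp: letter_permutation_def)
    then have "\<forall>v. snd (place r1 r2 n r3 r4 m (f v)) =
        snd ((\<lambda>(x, y). (x, 2 * (1/2) - y)) (place r1 r2 n r3 r4 m v))"
      by (auto simp: place_def)
    then show ?thesis
      unfolding axis_reflection_def by blast
  qed
  ultimately show ?thesis
    unfolding symmetric_graphs_def map_graph_def by blast
qed

text \<open>
  Letter permutations compose and make no reference to the residues and moduli. Hence this property
  is invariant under them and can be carried from one pair of class transpositions to the pair in
  the other order.
\<close>

definition classified :: "vertex ugraph \<Rightarrow> bool" where
  "classified H \<longleftrightarrow> (\<exists>f T. letter_permutation f \<and> basic_type T \<and> H = map_graph f T)"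

lemma classified_basic: "basic_type H \<Longrightarrow> classified H"
  unfolding classified_def using letter_permutation_id map_graph_id by metis

lemma classified_map_graph: "letter_permutation f \<Longrightarrow> classified H \<Longrightarrow> classified (map_graph f H)"
  unfolding classified_def using letter_permutation_comp map_graph_comp by metis

lemma classified_path_map:
  assumes "path_on (map f vs) H" "letter_permutation f"
    and "\<And>T. path_on vs T \<Longrightarrow> classified T"
  shows "classified H"
  using path_on_mapD[OF assms(1)] assms(2,3) classified_map_graph by metis

lemma classified_ab: "path_on [Va i, Vb i] H \<Longrightarrow> classified H"
  by (rule classified_basic) (auto simp: basic_type_def)

lemma classified_cd: "path_on [Vc j, Vd j] H \<Longrightarrow> classified H"
  by (rule classified_path_map[where vs = "[Va j, Vb j]", OF _ letter_permutation_swap_lines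
        classified_ab]) auto

lemma classified_bacd: "path_on [Vb i, Va i, Vc j, Vd j] H \<Longrightarrow> classified H"
  by (rule classified_basic) (auto simp: basic_type_def)

lemma classified_abcd: "path_on [Va i, Vb i, Vc j, Vd j] H \<Longrightarrow> classified H"
  by (rule classified_path_map[where vs = "[Vb i, Va i, Vc j, Vd j]",
        OF _ letter_permutation_swap_ab classified_bacd]) auto

lemma classified_cdab: "path_on [Vc j, Vd j, Va i, Vb i] H \<Longrightarrow> classified H"
  by (rule classified_basic) (auto simp: basic_type_def)

lemma classified_cdba: "path_on [Vc j, Vd j, Vb i, Va i] H \<Longrightarrow> classified H"
  by (rule classified_path_map[where vs = "[Vc j, Vd j, Va i, Vb i]",
        OF _ letter_permutation_swap_ab classified_cdab]) auto

lemma classified_bacdab: "path_on [Vb i, Va i, Vc j, Vd j, Va k, Vb k] H \<Longrightarrow> classified H"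
  by (rule classified_basic) (auto simp: basic_type_def)

lemma classified_abcdba: "path_on [Va i, Vb i, Vc j, Vd j, Vb k, Va k] H \<Longrightarrow> classified H"
  by (rule classified_path_map[where vs = "[Vb i, Va i, Vc j, Vd j, Va k, Vb k]",
        OF _ letter_permutation_swap_ab classified_bacdab]) auto

lemma classified_bacdba: "path_on [Vb i, Va i, Vc j, Vd j, Vb k, Va k] H \<Longrightarrow> classified H"
  by (rule classified_basic) (auto simp: basic_type_def)

lemma classified_abcdab: "path_on [Va i, Vb i, Vc j, Vd j, Va k, Vb k] H \<Longrightarrow> classified H"
  by (rule classified_path_map[where vs = "[Vb i, Va i, Vc j, Vd j, Vb k, Va k]",
        OF _ letter_permutation_swap_ab classified_bacdba]) auto

lemma classified_cdabcd: "path_on [Vc i, Vd i, Va j, Vb j, Vc k, Vd k] H \<Longrightarrow> classified H"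
  by (rule classified_path_map[where vs = "[Va i, Vb i, Vc j, Vd j, Va k, Vb k]",
        OF _ letter_permutation_swap_lines classified_abcdab]) auto

section \<open>Edges of the graph\<close>

fun partner :: "vertex \<Rightarrow> vertex" where
  "partner (Va k) = Vb k" | "partner (Vb k) = Va k"
| "partner (Vc k) = Vd k" | "partner (Vd k) = Vc k"

lemma partner_partner [simp]: "partner (partner v) = v"
  by (cases v) auto

text \<open>
  Through this fact, congruences between differences of residues become equalities.
\<close>

lemma small_multiple_eq_0:
  fixes m q w :: int
  assumes "m * q = w" "- m < w" "w < m"
  shows "q = 0"
proof -
  have "m > 0" "\<bar>m * q\<bar> < m * 1" using assms by auto
  then have "\<bar>q\<bar> < 1" by (simp add: abs_mult)
  then show ?thesis by simp
qed

lemma residue_class_disjoint: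
  fixes r s n :: int
  assumes "0 \<le> r" "r < s" "s < n"
  shows "residue_class r n \<inter> residue_class s n = {}"
proof -
  have "r + k * n \<noteq> s + l * n" for k l
  proof
    assume "r + k * n = s + l * n"
    then have e: "n * (k - l) = s - r" by (simp add: algebra_simps)
    then have "k - l = 0" using assms by (intro small_multiple_eq_0[OF e]) auto
    with e assms show False by simp
  qed
  then show ?thesis by (auto simp: residue_class_def)
qed

locale horizontal_pair =
  fixes r1 r2 n r3 r4 m :: int
  assumes bounds: "0 \<le> r1" "r1 < r2" "r2 < n" "0 \<le> r3" "r3 < r4" "r4 < m"
begin

abbreviation "pos \<equiv> mu r1 r2 n r3 r4 m"
abbreviation "\<Gamma> \<equiv> Gamma r1 r2 n r3 r4 m"

definition joint :: "vertex \<Rightarrow> vertex \<Rightarrow> bool" where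
  "joint u v \<longleftrightarrow> (u \<in> V1 \<longleftrightarrow> v \<notin> V1) \<and> pos u = pos v"

lemma pos_inj:
  assumes "pos u = pos v" "u \<in> V1 \<longleftrightarrow> v \<in> V1"
  shows "u = v"
proof -
  have r: "r1 + n * k \<noteq> r2 + n * l" "r2 + n * l \<noteq> r1 + n * k" for k l
    using residue_class_disjoint[of r1 r2 n] bounds
    by (force simp: residue_class_def mult.commute)+
  have r': "r3 + m * k \<noteq> r4 + m * l" "r4 + m * l \<noteq> r3 + m * k" for k l
    using residue_class_disjoint[of r3 r4 m] bounds
    by (force simp: residue_class_def mult.commute)+
  show ?thesis using assms r r' bounds by (cases u; cases v) auto
qed

lemma joint_sym: "joint u v \<longleftrightarrow> joint v u"
  by (auto simp: joint_def)

text \<open>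
  A joint determines all cross edges at a vertex. These equivalences are used as rewrite rules that
  list the neighbours of the vertices of an explicit path.
\<close>

lemma joint_iff: "joint u v \<Longrightarrow> joint u w \<longleftrightarrow> w = v"
  using pos_inj[of v w] by (auto simp: joint_def)

lemma class_transposition_pos:
  "class_transposition r1 n r2 n (pos u) = pos (partner u)" if "u \<in> V1"
  using that class_transposition_swaps[OF _ _ residue_class_disjoint[of r1 r2 n]] bounds
  by (cases u) (auto simp: mult.commute)

lemma class_transposition_pos':
  "class_transposition r3 m r4 m (pos u) = pos (partner u)" if "u \<notin> V1"
  using that class_transposition_swaps[OF _ _ residue_class_disjoint[of r3 r4 m]] bounds
  by (cases u) (auto simp: mult.commute)

lemma partner_V1_iff [simp]: "partner u \<in> V1 \<longleftrightarrow> u \<in> V1"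
  by (cases u) auto

text \<open>
  A class transposition moves the position of a vertex on its line to that of the partner, and
  positions on one line determine the vertex; hence its edges are exactly the partner edges.
\<close>

lemma edges_Gamma: "edges \<Gamma> = {{u, v} | u v. v = partner u \<or> joint u v}"
proof -
  have 1: "u \<in> V1 \<and> v \<in> V1 \<and> class_transposition r1 n r2 n (pos u) = pos v \<longleftrightarrow>
      u \<in> V1 \<and> v = partner u" for u v
    using class_transposition_pos pos_inj[of "partner u" v] by auto
  have 2: "u \<in> V2 \<and> v \<in> V2 \<and> class_transposition r3 m r4 m (pos u) = pos v \<longleftrightarrow>
      u \<notin> V1 \<and> v = partner u" for u v
    using class_transposition_pos' pos_inj[of "partner u" v] by (auto simp: V2_eq)
  have "{{u, v} | u v. joint u v} = {{u, v} | u v. u \<in> V1 \<and> v \<in> V2 \<and> pos u = pos v}"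
  proof -
    have "\<exists>u' v'. {u, v} = {u', v'} \<and> u' \<in> V1 \<and> v' \<in> V2 \<and> pos u' = pos v'" if "joint u v" for u v
    proof (cases "u \<in> V1")
      case True
      with that show ?thesis by (auto simp: joint_def V2_eq)
    next
      case False
      with that have "v \<in> V1 \<and> u \<in> V2 \<and> pos v = pos u" by (auto simp: joint_def V2_eq)
      then show ?thesis by (metis insert_commute)
    qed
    moreover have "joint u v" if "u \<in> V1" "v \<in> V2" "pos u = pos v" for u v
      using that by (auto simp: joint_def V2_eq)
    ultimately show ?thesis by blast
  qed
  moreover have "{{u, v} | u v. v = partner u \<or> joint u v} = {{u, v} | u v. joint u v} \<union>
      {{u, v} | u v. u \<in> V1 \<and> v = partner u} \<union> {{u, v} | u v. u \<notin> V1 \<and> v = partner u}"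
    by blast
  ultimately show ?thesis
    unfolding Gamma_def Let_def snd_conv 1 2 by (simp only:)
qed

lemma edge_iff: "{u, v} \<in> edges \<Gamma> \<longleftrightarrow> v = partner u \<or> joint u v"
proof
  assume "{u, v} \<in> edges \<Gamma>"
  then obtain u' v' where uv: "{u, v} = {u', v'}" "v' = partner u' \<or> joint u' v'"
    unfolding edges_Gamma by blast
  then consider "u = u'" "v = v'" | "u = v'" "v = u'"
    by (auto simp: doubleton_eq_iff)
  then show "v = partner u \<or> joint u v"
    using uv(2) joint_sym[of u v] by cases auto
qed (unfold edges_Gamma, blast)

lemma edge_doubleton: "\<forall>e\<in>edges \<Gamma>. \<exists>u v. e = {u, v}"
  by (auto simp: edges_Gamma)

lemma component_partner: "component \<Gamma> (partner u) = component \<Gamma> u"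
  using component_cong_edge[of u "partner u" \<Gamma>] by (simp add: edge_iff)

lemma component_joint: "joint u v \<Longrightarrow> component \<Gamma> u = component \<Gamma> v"
  by (rule component_cong_edge) (simp add: edge_iff)

lemma component_Gamma_eqI:
  assumes "S \<subseteq> reachable \<Gamma> u" "u \<in> S"
    and "\<forall>x\<in>S. {x, partner x} \<in> E \<and> (\<forall>y. joint x y \<longrightarrow> {x, y} \<in> E)"
    and "E \<subseteq> edges \<Gamma>" "\<forall>e\<in>E. e \<subseteq> S"
  shows "component \<Gamma> u = (S, E)"
  using assms(3-) by (intro component_eqI[OF edge_doubleton assms(1,2)]) (auto simp: edge_iff)

lemma component_pathI:
  assumes "distinct vs" "path_edges vs \<subseteq> edges \<Gamma>"
    and "\<forall>x\<in>set vs. {x, partner x} \<in> path_edges vs \<and>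
      (\<forall>y. joint x y \<longrightarrow> {x, y} \<in> path_edges vs)"
    and "u \<in> set vs"
  shows "path_on vs (component \<Gamma> u)"
  using assms(3) by (intro component_path[OF edge_doubleton assms(1,2,4)]) (auto simp: edge_iff)

definition free :: "vertex \<Rightarrow> bool" where
  "free u \<longleftrightarrow> (\<nexists>v. joint u v)"

section \<open>Components without an inner edge on the upper line\<close>

lemma classified_isolated_ab:
  assumes "free (Va k)" "free (Vb k)"
  shows "classified (component \<Gamma> (Va k))"
  using assms by (intro classified_ab component_pathI) (auto simp: edge_iff free_def insert_commute)

text \<open>
  The hypotheses say that an upper edge attached to the lower edge \<open>c d\<close> is not inner, so the
  component ends at its far vertex.
\<close>

lemma classified_pendant:
  assumes c: "\<And>x. joint (Vc j) x \<Longrightarrow> free (partner x)"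
    and d: "\<And>x. joint (Vd j) x \<Longrightarrow> free (partner x)"
  shows "classified (component \<Gamma> (Vc j))"
proof -
  consider (none) "free (Vc j)" "free (Vd j)"
    | (left) x where "joint (Vc j) x" "free (Vd j)"
    | (right) w where "free (Vc j)" "joint (Vd j) w"
    | (both) x w where "joint (Vc j) x" "joint (Vd j) w"
    by (auto simp: free_def)
  then show ?thesis
  proof cases
    case none
    have "path_on [Vc j, Vd j] (component \<Gamma> (Vc j))"
      using none by (intro component_pathI) (auto simp: edge_iff free_def insert_commute)
    then show ?thesis by (rule classified_cd)
  next
    case left
    note J = joint_iff[OF left(1)] joint_iff[OF left(1)[unfolded joint_sym[of "Vc j"]]]
    have F: "\<not> joint (Vd j) y" "\<not> joint (partner x) y" for y
      using left c by (auto simp: free_def)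
    have "x \<in> V1" using left by (auto simp: joint_def)
    then have D: "distinct [partner x, x, Vc j, Vd j]"
      by (cases x) auto
    have "path_on [partner x, x, Vc j, Vd j] (component \<Gamma> (Vc j))"
      by (rule component_pathI[OF D]) (simp_all add: edge_iff J F doubleton_eq_iff)
    then show ?thesis
      using \<open>x \<in> V1\<close> classified_abcd classified_bacd by (cases x) auto
  next
    case right
    note J = joint_iff[OF right(2)] joint_iff[OF right(2)[unfolded joint_sym[of "Vd j"]]]
    have F: "\<not> joint (Vc j) y" "\<not> joint (partner w) y" for y
      using right d by (auto simp: free_def)
    have "w \<in> V1" using right by (auto simp: joint_def)
    then have D: "distinct [Vc j, Vd j, w, partner w]"
      by (cases w) auto
    have "path_on [Vc j, Vd j, w, partner w] (component \<Gamma> (Vc j))"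
      by (rule component_pathI[OF D]) (simp_all add: edge_iff J F doubleton_eq_iff)
    then show ?thesis
      using \<open>w \<in> V1\<close> classified_cdab classified_cdba by (cases w) auto
  next
    case both
    note J = joint_iff[OF both(1)] joint_iff[OF both(1)[unfolded joint_sym[of "Vc j"]]]
      joint_iff[OF both(2)] joint_iff[OF both(2)[unfolded joint_sym[of "Vd j"]]]
    have F: "\<not> joint (partner x) y" "\<not> joint (partner w) y" for y
      using both c d by (auto simp: free_def)
    have V: "x \<in> V1" "w \<in> V1" using both by (auto simp: joint_def)
    have "x \<noteq> w" using J(2,4) by auto
    moreover have "partner x \<noteq> w" using F J(4) by auto
    ultimately have D: "distinct [partner x, x, Vc j, Vd j, w, partner w]"
      using V by (cases x; cases w) auto
    have "path_on [partner x, x, Vc j, Vd j, w, partner w] (component \<Gamma> (Vc j))"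
      by (rule component_pathI[OF D]) (simp_all add: edge_iff J F doubleton_eq_iff)
    then show ?thesis
      using V classified_abcdab classified_bacdba classified_abcdba classified_bacdab
      by (cases x; cases w) auto
  qed
qed

section \<open>Components with an inner edge on the line of the smaller modulus\<close>

lemma classified_square:
  assumes ac: "joint (Va k) (Vc i)" and bd: "joint (Vb k) (Vd i)"
  shows "classified (component \<Gamma> (Va k))"
proof -
  note J = joint_iff[OF ac] joint_iff[OF ac[unfolded joint_sym[of "Va k"]]]
    joint_iff[OF bd] joint_iff[OF bd[unfolded joint_sym[of "Vb k"]]]
  let ?S = "{Va k, Vb k, Vd i, Vc i}"
  let ?E = "{{Va k, Vb k}, {Vb k, Vd i}, {Vd i, Vc i}, {Vc i, Va k}}"
  have "path_edges [Va k, Vb k, Vd i, Vc i] \<subseteq> edges \<Gamma>"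
    by (simp add: edge_iff J)
  from path_reachable[OF this] have reach: "?S \<subseteq> reachable \<Gamma> (Va k)"
    by (simp add: subset_iff)
  have "component \<Gamma> (Va k) = (?S, ?E)"
    by (rule component_Gamma_eqI[OF reach]) (simp_all add: edge_iff J doubleton_eq_iff)
  then have "component \<Gamma> (Va k) = four_cycle (Va k) (Vb k) (Vd i) (Vc i)"
    by (simp add: four_cycle_def)
  then show ?thesis
    by (intro classified_basic) (auto simp: basic_type_def)
qed

text \<open>
  Comparing the positions of the two joints shows that \<open>s = r2 - r1\<close> is \<open>0\<close>, \<open>t\<close> or
  \<open>- t\<close> modulo \<open>m\<close>, where \<open>t = r4 - r3\<close>. The first is impossible because \<open>0 < s < m\<close>, and
  the other two give the square (\<open>s = t\<close>) and the paths around \<open>c d a b c d\<close>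
  (\<open>s + t = m\<close>).
\<close>

lemma classified_inner_ab:
  assumes "n \<le> m" and "\<not> free (Va k)" and "\<not> free (Vb k)"
  shows "classified (component \<Gamma> (Va k))"
proof -
  obtain p q where p: "joint (Va k) p" and q: "joint (Vb k) q"
    using assms by (auto simp: free_def)
  have V: "p \<notin> V1" "q \<notin> V1" using p q by (auto simp: joint_def)
  consider (cc) i j where "p = Vc i" "q = Vc j" | (dd) i j where "p = Vd i" "q = Vd j"
    | (cd) i j where "p = Vc i" "q = Vd j" | (dc) i j where "p = Vd i" "q = Vc j"
    using V by (cases p; cases q) auto
  then show ?thesis
  proof cases
    case cc
    then have e: "m * (j - i) = r2 - r1"
      using p q by (simp add: joint_def algebra_simps)
    have "j - i = 0" by (rule small_multiple_eq_0[OF e]) (use bounds \<open>n \<le> m\<close> in auto)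
    with e bounds show ?thesis by simp
  next
    case dd
    then have e: "m * (j - i) = r2 - r1"
      using p q by (simp add: joint_def algebra_simps)
    have "j - i = 0" by (rule small_multiple_eq_0[OF e]) (use bounds \<open>n \<le> m\<close> in auto)
    with e bounds show ?thesis by simp
  next
    case cd
    then have e: "m * (j - i) = (r2 - r1) - (r4 - r3)"
      using p q by (simp add: joint_def algebra_simps)
    have "j - i = 0" by (rule small_multiple_eq_0[OF e]) (use bounds \<open>n \<le> m\<close> in auto)
    with cd p q show ?thesis by (intro classified_square[of k i]) auto
  next
    case dc
    have pe: "r1 + n * k = r4 + m * i" and qe: "r2 + n * k = r3 + m * j"
      using p q dc by (auto simp: joint_def)
    then have e: "m * (j - i - 1) = (r2 - r1) + (r4 - r3) - m"
      by (simp add: algebra_simps)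
    have "j - i - 1 = 0" by (rule small_multiple_eq_0[OF e]) (use bounds \<open>n \<le> m\<close> in auto)
    then have j: "j = i + 1" and m: "m = (r2 - r1) + (r4 - r3)" using e by auto
    have "i \<noteq> j" using j by simp
    \<comment> \<open>The bound \<open>r4 < m\<close> gives \<open>r3 < s \<le> r2\<close>, so \<open>r2\<close> and \<open>r3\<close> are distinct residues modulo \<open>n\<close>,
        whereas the joint of \<open>b\<close> and \<open>c\<close> makes them congruent modulo any common divisor of
        \<open>n\<close> and \<open>m\<close>, hence modulo \<open>n\<close> if it divides \<open>m\<close>.\<close>
    have not_dvd: "\<not> n dvd m"
    proof
      assume "n dvd m"
      then obtain z where z: "m = n * z" by (elim dvdE)
      have e': "n * (z * j - k) = r2 - r3"
        using qe unfolding z by (simp add: algebra_simps)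
      have "z * j - k = 0" by (rule small_multiple_eq_0[OF e']) (use bounds m in auto)
      with e' m bounds show False by simp
    qed
    have left_b: "\<not> joint (Vc i) (Vb l)" for l
    proof
      assume "joint (Vc i) (Vb l)"
      then have "n * (k - l) = (r2 - r1) + (r4 - r3)"
        using pe by (simp add: joint_def algebra_simps)
      then have "m = n * (k - l)" using m by simp
      then show False using not_dvd by simp
    qed
    have right_a: "\<not> joint (Vd j) (Va l)" for l
    proof
      assume "joint (Vd j) (Va l)"
      then have "n * (l - k) = (r2 - r1) + (r4 - r3)"
        using qe by (simp add: joint_def algebra_simps)
      then have "m = n * (l - k)" using m by simp
      then show False using not_dvd by simp
    qed
    \<comment> \<open>Both ends of the path continue under the same condition: the joint on the right is the
        point reflection of the joint on the left about the edge with index \<open>k\<close>.\<close>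
    have left_iff: "joint (Vc i) (Va l) \<longleftrightarrow> r4 - r3 = n * (k - l)" for l
      using pe by (auto simp: joint_def algebra_simps)
    have right_iff: "joint (Vd j) (Vb (2 * k - l)) \<longleftrightarrow> r4 - r3 = n * (k - l)" for l
      using qe by (auto simp: joint_def algebra_simps)
    note J = joint_iff[OF p[unfolded dc]] joint_iff[OF p[unfolded dc joint_sym[of "Va k"]]]
      joint_iff[OF q[unfolded dc]] joint_iff[OF q[unfolded dc joint_sym[of "Vb k"]]]
    show ?thesis
    proof (cases "\<exists>l. r4 - r3 = n * (k - l)")
      case False
      have F: "\<not> joint (Vc i) y" "\<not> joint (Vd j) y" for y
      proof -
        show "\<not> joint (Vc i) y"
          using False left_iff left_b by (cases y) (auto simp: joint_def)
        have "\<not> joint (Vd j) (Vb l)" for l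
        proof
          assume "joint (Vd j) (Vb l)"
          then have "r4 - r3 = n * (k - (2 * k - l))"
            using right_iff[of "2 * k - l"] by simp
          then show False using False by blast
        qed
        then show "\<not> joint (Vd j) y"
          using right_a by (cases y) (auto simp: joint_def)
      qed
      have "path_on [Vc i, Vd i, Va k, Vb k, Vc j, Vd j] (component \<Gamma> (Va k))"
        using \<open>i \<noteq> j\<close> by (intro component_pathI) (simp_all add: edge_iff J F doubleton_eq_iff)
      then show ?thesis by (rule classified_cdabcd)
    next
      case True
      then obtain l where l: "r4 - r3 = n * (k - l)" ..
      define h where "h = 2 * k - l"
      have ca: "joint (Vc i) (Va l)" and db: "joint (Vd j) (Vb h)"
        using l left_iff right_iff by (auto simp: h_def)
      note J' = joint_iff[OF ca] joint_iff[OF ca[unfolded joint_sym[of "Vc i"]]]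
        joint_iff[OF db] joint_iff[OF db[unfolded joint_sym[of "Vd j"]]]
      have "l \<noteq> k" using l bounds by auto
      \<comment> \<open>Here \<open>t\<close> is a multiple of \<open>n\<close>, while \<open>0 < s < n\<close>.\<close>
      have neq: "r2 - r1 \<noteq> r4 - r3"
      proof
        assume e: "r2 - r1 = r4 - r3"
        with l have "n * (k - l) = r2 - r1" by simp
        from small_multiple_eq_0[OF this] bounds \<open>l \<noteq> k\<close> show False by simp
      qed
      \<comment> \<open>The two new end vertices lie at distance \<open>s\<close> from a \<open>c\<close> and a \<open>d\<close>; a further joint would
        make \<open>s\<close> or \<open>s - t\<close> a multiple of \<open>m\<close>.\<close>
      have F: "\<not> joint (Vb l) y" "\<not> joint (Va h) y" for y
      proof -
        have s: "m * z \<noteq> r2 - r1" and st: "m * z \<noteq> (r2 - r1) - (r4 - r3)" for z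
          using small_multiple_eq_0[of m z] bounds \<open>n \<le> m\<close> neq by fastforce+
        have ca': "r3 + m * i = r1 + n * l" and db': "r4 + m * j = r2 + n * h"
          using ca db by (auto simp: joint_def)
        show "\<not> joint (Vb l) y"
        proof (cases y)
          case (Vc z) then show ?thesis
            using s[of "z - i"] ca' by (auto simp: joint_def algebra_simps)
        next
          case (Vd z) then show ?thesis
            using st[of "z - i"] ca' by (auto simp: joint_def algebra_simps)
        qed (auto simp: joint_def)
        show "\<not> joint (Va h) y"
        proof (cases y)
          case (Vc z) then show ?thesis
            using st[of "j - z"] db' by (auto simp: joint_def algebra_simps)
        next
          case (Vd z) then show ?thesis
            using s[of "j - z"] db' by (auto simp: joint_def algebra_simps)
        qed (auto simp: joint_def)
      qed
      let ?vs = "[Vb l, Va l, Vc i, Vd i, Va k, Vb k, Vc j, Vd j, Vb h, Va h]"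
      have "path_on ?vs (component \<Gamma> (Va k))"
      proof (rule component_pathI)
        show "distinct ?vs" using \<open>l \<noteq> k\<close> \<open>i \<noteq> j\<close> by (auto simp: h_def)
      qed (simp_all add: edge_iff J J' F doubleton_eq_iff)
      then show ?thesis
        by (intro classified_basic) (auto simp: basic_type_def)
    qed
  qed
qed

text \<open>
  The inner upper edge in the component of a lower edge need not be searched for along the path: if
  none of the at most two upper edges attached to the lower edge is inner, the component ends there.
\<close>

lemma classified_component_if_le:
  assumes "n \<le> m"
  shows "classified (component \<Gamma> u)"
proof -
  have inner: "classified (component \<Gamma> x)" if "x \<in> V1" "\<not> free x" "\<not> free (partner x)" for x
    using that classified_inner_ab[OF assms] component_partner[of "Va _"] by (cases x) auto
  have Vc: "classified (component \<Gamma> (Vc j))" for j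
  proof (cases "\<exists>x. (joint (Vc j) x \<or> joint (Vd j) x) \<and> \<not> free (partner x)")
    case True
    then obtain x where x: "joint (Vc j) x \<or> joint (Vd j) x" "\<not> free (partner x)" by blast
    then have "joint x (Vc j) \<or> joint x (Vd j)" by (simp add: joint_sym[of x])
    then have "\<not> free x" "x \<in> V1" unfolding free_def by (blast, auto simp: joint_def)
    moreover have "component \<Gamma> (Vc j) = component \<Gamma> x"
      using x component_joint component_partner[of "Vc j"] by auto
    ultimately show ?thesis using inner x by simp
  qed (intro classified_pendant; blast)
  have lower: "classified (component \<Gamma> v)" if "v \<notin> V1" for v
    using that Vc component_partner[of "Vc _"] by (cases v) auto
  have Va: "classified (component \<Gamma> (Va k))" for k
  proof (cases "free (Va k) \<and> free (Vb k)")
    case False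
    then obtain v where v: "joint (Va k) v \<or> joint (Vb k) v" by (auto simp: free_def)
    then have "v \<notin> V1" by (auto simp: joint_def)
    moreover have "component \<Gamma> (Va k) = component \<Gamma> v"
      using v component_joint component_partner[of "Va k"] by auto
    ultimately show ?thesis using lower by simp
  qed (auto intro: classified_isolated_ab)
  show ?thesis
    using Va Vc component_partner[of "Va _"] component_partner[of "Vc _"] by (cases u) auto
qed

end

section \<open>Exchanging the two lines\<close>

lemma mu_swap_lines: "mu r3 r4 m r1 r2 n (swap_lines v) = mu r1 r2 n r3 r4 m v"
  by (cases v) auto

lemma Gamma_swap_lines:
  assumes "horizontal_pair r1 r2 n r3 r4 m"
  shows "Gamma r3 r4 m r1 r2 n = map_graph swap_lines (Gamma r1 r2 n r3 r4 m)"
proof -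
  interpret horizontal_pair r1 r2 n r3 r4 m by fact
  interpret swapped: horizontal_pair r3 r4 m r1 r2 n
    using bounds by unfold_locales
  have line: "swap_lines v \<in> V1 \<longleftrightarrow> v \<notin> V1" for v
    by (cases v) auto
  have partner: "partner (swap_lines v) = swap_lines (partner v)" for v
    by (cases v) auto
  have joint: "swapped.joint (swap_lines u) (swap_lines v) \<longleftrightarrow> joint u v" for u v
    by (auto simp: joint_def swapped.joint_def mu_swap_lines line)
  have "verts (Gamma r3 r4 m r1 r2 n) = UNIV" "verts (Gamma r1 r2 n r3 r4 m) = UNIV"
    by (auto simp: Gamma_def Let_def V2_eq)
  moreover have "edges (Gamma r3 r4 m r1 r2 n) = (\<lambda>e. swap_lines ` e) ` edges (Gamma r1 r2 n r3 r4 m)"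
  proof (intro set_eqI iffI)
    fix e assume "e \<in> edges (Gamma r3 r4 m r1 r2 n)"
    then obtain u v where e: "e = {u, v}" "v = partner u \<or> swapped.joint u v"
      by (auto simp: swapped.edges_Gamma)
    then have "{swap_lines u, swap_lines v} \<in> edges (Gamma r1 r2 n r3 r4 m)"
      using joint[of "swap_lines u" "swap_lines v"] partner by (auto simp: edge_iff)
    moreover have "e = swap_lines ` {swap_lines u, swap_lines v}" using e by simp
    ultimately show "e \<in> (\<lambda>e. swap_lines ` e) ` edges (Gamma r1 r2 n r3 r4 m)" by blast
  next
    fix e assume "e \<in> (\<lambda>e. swap_lines ` e) ` edges (Gamma r1 r2 n r3 r4 m)"
    then obtain u v where "e = {swap_lines u, swap_lines v}" "v = partner u \<or> joint u v"
      by (auto simp: edges_Gamma)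
    then show "e \<in> edges (Gamma r3 r4 m r1 r2 n)"
      using joint partner by (auto simp: swapped.edge_iff)
  qed
  ultimately show ?thesis
    using bij_swap_lines by (intro prod_eqI) (auto simp: map_graph_def bij_def)
qed

lemma (in horizontal_pair) classified_component: "classified (component \<Gamma> u)"
proof (cases "n \<le> m")
  case False
  interpret swapped: horizontal_pair r3 r4 m r1 r2 n
    using bounds by unfold_locales
  have "component \<Gamma> u = map_graph swap_lines (component (Gamma r3 r4 m r1 r2 n) (swap_lines u))"
    using component_map_graph[OF bij_swap_lines, of "Gamma r3 r4 m r1 r2 n" "swap_lines u"]
      Gamma_swap_lines[OF swapped.horizontal_pair_axioms] by simp
  then show ?thesis
    using swapped.classified_component_if_le False letter_permutation_swap_lines
    by (simp add: classified_map_graph)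
qed (rule classified_component_if_le)

theorem theorem5p4:
  fixes r1 r2 n r3 r4 m :: int and H :: "vertex ugraph"
  assumes "0 \<le> r1" and "r1 < r2" and "r2 < n"
    and "0 \<le> r3" and "r3 < r4" and "r4 < m"
    and "connected_component_graph (Gamma r1 r2 n r3 r4 m) H"
  shows "basic_type H \<or>
         (\<exists>T. basic_type T \<and> symmetric_graphs r1 r2 n r3 r4 m T H)"
proof -
  interpret horizontal_pair r1 r2 n r3 r4 m
    using assms by unfold_locales
  obtain u where "H = component (Gamma r1 r2 n r3 r4 m) u"
    using assms(7) by (auto simp: connected_component_graph_def component_def)
  then have "classified H" using classified_component by simp
  then show ?thesis
    unfolding classified_def using symmetric_graphs_map_graph by blast
qed

end
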